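(* Let $\Gamma^t=\mathrm{Image}(\boldsymbol{X}(\cdot,t))$ be a smooth time-dependent family of closed convex plane curves (curvature $k>0$), and let $S$ be the affine arc-length parameterization of $\Gamma^t$. If $\boldsymbol{X}$ is a solution to the affine intrinsic heat equation $\partial_t\boldsymbol{X}=\partial_S^2\boldsymbol{X}$, then it represents a flow of planar curves with normal velocity $\beta=k^{1/3}$ and the crystalline curvature adjusted tangential velocity $\alpha=-\dfrac{\partial_s\beta}{k}$, i.e. $$\partial_t\boldsymbol{X}=\beta\boldsymbol{N}+\alpha\boldsymbol{T}\quad\text{with}\quad\beta=k^{1/3},\qquad\alpha=-\frac{\partial_s\beta}{k}.$$
   Context: For a regular closed plane curve, $s$ is the arc-length parameter, $\boldsymbol{T}=\partial_s\boldsymbol{X}$ is the unit tangent vector, $\boldsymbol{N}$ is the unit inward normal with $\det(\boldsymbol{T},\boldsymbol{N})=1$, and $k=\det(\partial_s\boldsymbol{X},\partial_s^2\boldsymbol{X})$ is the curvature. A parameterization $S$ with $dS=\vartheta\,ds$, where $\vartheta\ge0$ is a function on the curve (so $\partial_S=\vartheta^{-1}\partial_s$), is called the affine arc-length parameterization if $|K|\equiv1$ on the curve, where $K=\det(\partial_S\boldsymbol{X},\partial_S^2\boldsymbol{X})$. In the evolution equation, $\partial_t$ is the time derivative of the position vector at a fixed value of the underlying (time-independent) parameter of the curve, and at each time $\partial_S$ is the derivative with respect to the affine arc-length of $\Gamma^t$. *)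

theory Defs
  imports "HOL-Analysis.Analysis"
begin

primrec times_cont_differentiable_on ::
    "nat \<Rightarrow> ('a::euclidean_space \<Rightarrow> 'b::real_normed_vector) \<Rightarrow> 'a set \<Rightarrow> bool" where
  "times_cont_differentiable_on 0 f U \<longleftrightarrow> continuous_on U f"
| "times_cont_differentiable_on (Suc n) f U \<longleftrightarrow>
     (\<forall>x\<in>U. f differentiable (at x)) \<and>
     (\<forall>v. times_cont_differentiable_on n (\<lambda>x. frechet_derivative f (at x) v) U)"

text \<open>The domain need not be open (a time interval may contain its end points): a function is
  smooth if it extends to a smooth function on an open neighbourhood.\<close>

definition smooth_on ::
    "('a::euclidean_space \<Rightarrow> 'b::real_normed_vector) \<Rightarrow> 'a set \<Rightarrow> bool" where
  "smooth_on f A \<longleftrightarrow> (\<exists>U g. open U \<and> A \<subseteq> U \<and>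
     (\<forall>n. times_cont_differentiable_on n g U) \<and> (\<forall>x\<in>A. g x = f x))"

definition det2 :: "real^2 \<Rightarrow> real^2 \<Rightarrow> real" where
  "det2 a b = det (vector [a, b] :: real^2^2)"

text \<open>Closed curves are represented by periodic maps \<open>\<gamma>\<close> on the real line, and functions on the
  curve by functions of the parameter \<open>u\<close> of \<open>\<gamma>\<close>. The arc length satisfies
  \<open>ds = speed \<gamma> u du\<close>, so \<open>\<partial>\<^sub>s = (1 / speed \<gamma> u) \<partial>\<^sub>u\<close>.\<close>

definition speed :: "(real \<Rightarrow> real^2) \<Rightarrow> real \<Rightarrow> real" where
  "speed \<gamma> u = norm (vector_derivative \<gamma> (at u))"

definition arc_deriv ::
    "(real \<Rightarrow> real^2) \<Rightarrow> (real \<Rightarrow> 'a::real_normed_vector) \<Rightarrow> real \<Rightarrow> 'a" where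
  "arc_deriv \<gamma> f u = inverse (speed \<gamma> u) *\<^sub>R vector_derivative f (at u)"

definition tangent :: "(real \<Rightarrow> real^2) \<Rightarrow> real \<Rightarrow> real^2" where
  "tangent \<gamma> = arc_deriv \<gamma> \<gamma>"

text \<open>On a convex curve with positive curvature, the unit normal singled out by the determinant
  condition is the inward one.\<close>

definition unit_normal :: "(real \<Rightarrow> real^2) \<Rightarrow> real \<Rightarrow> real^2" where
  "unit_normal \<gamma> u =
     (THE n. norm n = 1 \<and> orthogonal (tangent \<gamma> u) n \<and> det2 (tangent \<gamma> u) n = 1)"

lemma unit_normal_unique:
  fixes T :: "real^2"
  assumes "norm T = 1"
  shows "\<exists>!n. norm n = 1 \<and> orthogonal T n \<and> det2 T n = 1"
proof (rule ex1I)
  have T: "(T$1)^2 + (T$2)^2 = 1"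
    using assms by (simp add: norm_eq_1 inner_vec_def sum_2 power2_eq_square)
  let ?n = "vector [- T$2, T$1] :: real^2"
  show "norm ?n = 1 \<and> orthogonal T ?n \<and> det2 T ?n = 1"
    using T by (simp add: norm_eq_1 orthogonal_def inner_vec_def sum_2 det2_def det_2
        power2_eq_square)
  fix n :: "real^2"
  assume "norm n = 1 \<and> orthogonal T n \<and> det2 T n = 1"
  then have o: "T$1 * n$1 + T$2 * n$2 = 0" and d: "T$1 * n$2 - T$2 * n$1 = 1"
    by (simp_all add: orthogonal_def inner_vec_def sum_2 det2_def det_2)
  have "n$1 = - T$2" "n$2 = T$1"
    using T o d by algebra+
  then show "n = ?n" by (simp add: vec_eq_iff forall_2)
qed

definition curvature :: "(real \<Rightarrow> real^2) \<Rightarrow> real \<Rightarrow> real" where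
  "curvature \<gamma> u = det2 (arc_deriv \<gamma> \<gamma> u) (arc_deriv \<gamma> (arc_deriv \<gamma> \<gamma>) u)"

definition regular_closed_curve :: "real \<Rightarrow> (real \<Rightarrow> real^2) \<Rightarrow> bool" where
  "regular_closed_curve p \<gamma> \<longleftrightarrow> p > 0 \<and> smooth_on \<gamma> UNIV \<and>
     (\<forall>u. \<gamma> (u + p) = \<gamma> u) \<and> (\<forall>u. vector_derivative \<gamma> (at u) \<noteq> 0)"

definition closed_convex_curve :: "real \<Rightarrow> (real \<Rightarrow> real^2) \<Rightarrow> bool" where
  "closed_convex_curve p \<gamma> \<longleftrightarrow> regular_closed_curve p \<gamma> \<and> inj_on \<gamma> {0..<p} \<and>
     range \<gamma> = frontier (convex hull (range \<gamma>)) \<and> (\<forall>u. curvature \<gamma> u > 0)"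

text \<open>For a parameterization \<open>S\<close> with \<open>dS = \<theta> ds\<close>: \<open>\<partial>\<^sub>S = (1 / \<theta>) \<partial>\<^sub>s\<close>.\<close>

definition S_deriv ::
    "(real \<Rightarrow> real^2) \<Rightarrow> (real \<Rightarrow> real) \<Rightarrow> (real \<Rightarrow> 'a::real_normed_vector) \<Rightarrow> real \<Rightarrow> 'a" where
  "S_deriv \<gamma> \<theta> f u = inverse (\<theta> u) *\<^sub>R arc_deriv \<gamma> f u"

definition S_curvature :: "(real \<Rightarrow> real^2) \<Rightarrow> (real \<Rightarrow> real) \<Rightarrow> real \<Rightarrow> real" where
  "S_curvature \<gamma> \<theta> u = det2 (S_deriv \<gamma> \<theta> \<gamma> u) (S_deriv \<gamma> \<theta> (S_deriv \<gamma> \<theta> \<gamma>) u)"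

text \<open>Being defined on the line rather than on the closed curve, \<open>S\<close> increases by the total
  affine length over each period; only its density \<open>\<theta>\<close> is periodic. Differentiability of \<open>\<theta>\<close>
  makes the second \<open>S\<close>-derivative of \<open>\<gamma>\<close> meaningful. Zeros of \<open>\<theta>\<close> are not excluded explicitly, but
  at a zero \<open>S_deriv\<close> is \<open>0\<close>, which contradicts the last condition.\<close>

definition affine_arc_length ::
    "real \<Rightarrow> (real \<Rightarrow> real^2) \<Rightarrow> (real \<Rightarrow> real) \<Rightarrow> (real \<Rightarrow> real) \<Rightarrow> bool" where
  "affine_arc_length p \<gamma> S \<theta> \<longleftrightarrow>
     (\<forall>u. \<theta> u \<ge> 0 \<and> \<theta> (u + p) = \<theta> u \<and> \<theta> differentiable (at u)) \<and>
     (\<forall>u. (S has_real_derivative \<theta> u * speed \<gamma> u) (at u)) \<and>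
     (\<forall>u. \<bar>S_curvature \<gamma> \<theta> u\<bar> = 1)"

end

theory Submission
  imports Defs
begin

text \<open>At a fixed time, the Frenet equation gives
  \<open>\<partial>\<^sub>S\<^sup>2 X = (k / \<theta>\<^sup>2) N - (\<partial>\<^sub>s \<theta> / \<theta>\<^sup>3) T\<close>, hence
  \<open>K = k / \<theta>\<^sup>3\<close>. Since \<open>k > 0\<close>, the normalisation \<open>\<bar>K\<bar> = 1\<close> forces
  \<open>\<theta> = k\<^sup>1\<^sup>/\<^sup>3\<close>, which turns the coefficients into \<open>\<beta>\<close> and \<open>\<alpha>\<close>.\<close>

lemma det2_eq: "det2 a b = a$1 * b$2 - a$2 * b$1"
  by (simp add: det2_def det_2)

lemma smooth_on_UNIV_twice_differentiable:
  fixes \<gamma> :: "real \<Rightarrow> 'a::real_normed_vector"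
  assumes "smooth_on \<gamma> UNIV"
  shows "\<gamma> differentiable (at u)" "(\<lambda>w. vector_derivative \<gamma> (at w)) differentiable (at u)"
proof -
  obtain g where g: "\<And>n. times_cont_differentiable_on n g UNIV" and "\<forall>x. g x = \<gamma> x"
    using assms by (auto simp: smooth_on_def top.extremum_unique)
  \<comment> \<open>On the whole line nothing is left to extend, so the smooth extension is the
    curve itself.\<close>
  then have "g = \<gamma>"
    by blast
  then have *: "times_cont_differentiable_on (Suc (Suc 0)) \<gamma> UNIV"
    using g by blast
  then have d: "\<gamma> differentiable (at w)" for w
    by simp
  then show "\<gamma> differentiable (at u)" .
  \<comment> \<open>Smoothness is phrased by directional derivatives; direction \<open>1\<close>
    recovers the vector derivative.\<close>
  have "(\<lambda>w. frechet_derivative \<gamma> (at w) 1) differentiable (at u)"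
    using * by simp
  moreover have "frechet_derivative \<gamma> (at w) 1 = vector_derivative \<gamma> (at w)" for w
    using frechet_derivative_eq_vector_derivative[OF d] by simp
  ultimately show "(\<lambda>w. vector_derivative \<gamma> (at w)) differentiable (at u)"
    by simp
qed

lemma unit_normal_eqI:
  assumes "norm (tangent \<gamma> u) = 1" "norm n = 1" "orthogonal (tangent \<gamma> u) n" "det2 (tangent \<gamma> u) n = 1"
  shows "unit_normal \<gamma> u = n"
  unfolding unit_normal_def using assms unit_normal_unique[of "tangent \<gamma> u"]
  by (intro the1_equality) auto

text \<open>A counterclockwise quarter turn of the tangent meets all three conditions; the
  coordinates allow componentwise computation below.\<close>

lemma unit_normal_eq:
  assumes "norm (tangent \<gamma> u) = 1"
  shows "unit_normal \<gamma> u = vector [- tangent \<gamma> u $ 2, tangent \<gamma> u $ 1]"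
  using assms
  by (intro unit_normal_eqI)
     (simp_all add: det2_eq norm_eq_1 orthogonal_def inner_vec_def sum_2)

context
  fixes p :: real and \<gamma> :: "real \<Rightarrow> real^2"
  assumes reg: "regular_closed_curve p \<gamma>"
begin

lemma speed_pos: "speed \<gamma> u > 0"
  using reg by (simp add: speed_def regular_closed_curve_def)

lemma norm_tangent: "norm (tangent \<gamma> u) = 1"
  using speed_pos[of u] by (simp add: tangent_def arc_deriv_def speed_def)

lemma tangent_differentiable: "tangent \<gamma> differentiable (at u)"
proof -
  have sm: "smooth_on \<gamma> UNIV"
    using reg by (simp add: regular_closed_curve_def)
  have v: "(\<lambda>w. vector_derivative \<gamma> (at w)) differentiable (at u)"
    by (rule smooth_on_UNIV_twice_differentiable[OF sm])
  moreover have "vector_derivative \<gamma> (at u) \<noteq> 0"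
    using reg by (simp add: regular_closed_curve_def)
  \<comment> \<open>The norm is differentiable only away from \<open>0\<close>, so regularity of the
    curve enters here.\<close>
  ultimately have "speed \<gamma> differentiable (at u)"
    unfolding speed_def
    by (intro differentiable_compose[of norm "\<lambda>w. vector_derivative \<gamma> (at w)"]
        differentiable_norm_at)
  then show ?thesis
    unfolding tangent_def arc_deriv_def using v speed_pos[of u]
    by (intro differentiable_scaleR differentiable_inverse) auto
qed

text \<open>First Frenet equation. A unit field is orthogonal to its derivative, so the derivative
  is a multiple of the normal; the factor is its determinant with the tangent, which is how
  curvature is defined.\<close>

lemma arc_deriv_tangent:
  "arc_deriv \<gamma> (tangent \<gamma>) u = curvature \<gamma> u *\<^sub>R unit_normal \<gamma> u"
proof -
  let ?T = "tangent \<gamma>" and ?w = "arc_deriv \<gamma> (tangent \<gamma>) u"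
  have d: "(?T has_vector_derivative vector_derivative ?T (at u)) (at u)"
    using tangent_differentiable vector_derivative_works by blast
  \<comment> \<open>Differentiate the constant T . T = 1 to get orthogonality.\<close>
  have "((\<lambda>w. ?T w \<bullet> ?T w) has_real_derivative
      2 * (?T u \<bullet> vector_derivative ?T (at u))) (at u)"
    using has_derivative_inner[OF d[unfolded has_vector_derivative_def]
        d[unfolded has_vector_derivative_def]]
    by (simp add: has_field_derivative_def inner_commute algebra_simps mult_commute_abs)
  moreover have "(\<lambda>w. ?T w \<bullet> ?T w) = (\<lambda>w. 1)"
    using norm_tangent by (simp add: norm_eq_1)
  ultimately have "?T u \<bullet> vector_derivative ?T (at u) = 0"
    using DERIV_unique[OF _ DERIV_const] by fastforce
  then have "?T u \<bullet> ?w = 0"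
    by (simp add: arc_deriv_def)
  then have o: "?T u $ 1 * ?w $ 1 + ?T u $ 2 * ?w $ 2 = 0"
    by (simp add: inner_vec_def sum_2)
  have k: "curvature \<gamma> u = ?T u $ 1 * ?w $ 2 - ?T u $ 2 * ?w $ 1"
    by (simp add: curvature_def det2_eq tangent_def)
  have n: "(?T u $ 1)\<^sup>2 + (?T u $ 2)\<^sup>2 = 1"
    using norm_tangent[of u] by (simp add: norm_eq_1 inner_vec_def sum_2 power2_eq_square)
  \<comment> \<open>\<open>o\<close> and \<open>k\<close> form a linear system for the two
    components of \<open>?w\<close>, with determinant 1 by \<open>n\<close>.\<close>
  have "?w $ 1 = - curvature \<gamma> u * ?T u $ 2" "?w $ 2 = curvature \<gamma> u * ?T u $ 1"
    using o k n by algebra+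
  then show ?thesis
    by (simp add: unit_normal_eq norm_tangent vec_eq_iff forall_2)
qed

text \<open>Product rule for T / \<theta>: differentiating T yields the normal term by Frenet,
  differentiating 1 / \<theta> the tangential one.\<close>

lemma S_deriv_twice:
  assumes "\<theta> u \<noteq> 0" "\<theta> differentiable (at u)"
  shows "S_deriv \<gamma> \<theta> (S_deriv \<gamma> \<theta> \<gamma>) u =
    (curvature \<gamma> u / (\<theta> u)\<^sup>2) *\<^sub>R unit_normal \<gamma> u
      - (arc_deriv \<gamma> \<theta> u / (\<theta> u)^3) *\<^sub>R tangent \<gamma> u"
proof -
  define D where "D = vector_derivative \<theta> (at u)"
  define E where "E = vector_derivative (tangent \<gamma>) (at u)"
  have "(\<theta> has_real_derivative D) (at u)"
    using assms(2) vector_derivative_works has_real_derivative_iff_has_vector_derivative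
    unfolding D_def by blast
  then have i: "((\<lambda>w. inverse (\<theta> w)) has_real_derivative - (D / (\<theta> u)\<^sup>2)) (at u)"
    using assms(1) by (auto intro!: derivative_eq_intros simp: field_simps power2_eq_square)
  have T: "(tangent \<gamma> has_vector_derivative E) (at u)"
    using tangent_differentiable vector_derivative_works unfolding E_def by blast
  have "S_deriv \<gamma> \<theta> \<gamma> = (\<lambda>w. inverse (\<theta> w) *\<^sub>R tangent \<gamma> w)"
    by (simp add: S_deriv_def tangent_def fun_eq_iff)
  then have v: "vector_derivative (S_deriv \<gamma> \<theta> \<gamma>) (at u) =
      inverse (\<theta> u) *\<^sub>R E + (- (D / (\<theta> u)\<^sup>2)) *\<^sub>R tangent \<gamma> u"
    using has_vector_derivative_scaleR[OF i T] by (simp add: vector_derivative_at)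
  \<comment> \<open>Both scalings are merged so that the outer operator exposes the vector
    derivative computed in \<open>v\<close>; the inner one, not applied to \<open>u\<close>, stays
    intact.\<close>
  have S: "S_deriv \<gamma> \<theta> f u =
      (inverse (\<theta> u) * inverse (speed \<gamma> u)) *\<^sub>R vector_derivative f (at u)"
    for f :: "real \<Rightarrow> real^2"
    by (simp add: S_deriv_def arc_deriv_def)
  have "S_deriv \<gamma> \<theta> (S_deriv \<gamma> \<theta> \<gamma>) u =
      (1 / (\<theta> u)\<^sup>2) *\<^sub>R arc_deriv \<gamma> (tangent \<gamma>) u
        - (arc_deriv \<gamma> \<theta> u / (\<theta> u)^3) *\<^sub>R tangent \<gamma> u"
    unfolding S v
    by (simp add: arc_deriv_def algebra_simps power2_eq_square power3_eq_cube divide_inverse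
        flip: D_def E_def)
  then show ?thesis
    by (simp add: arc_deriv_tangent)
qed

text \<open>The tangential part drops out since det(T, T) = 0, and det(T, N) = 1. One factor 1 /
  \<theta> comes from the first S-derivative, two from the second.\<close>

lemma S_curvature_eq:
  assumes "\<theta> u \<noteq> 0" "\<theta> differentiable (at u)"
  shows "S_curvature \<gamma> \<theta> u = curvature \<gamma> u / (\<theta> u)^3"
proof -
  have n: "(tangent \<gamma> u $ 1)\<^sup>2 + (tangent \<gamma> u $ 2)\<^sup>2 = 1"
    using norm_tangent[of u] by (simp add: norm_eq_1 inner_vec_def sum_2 power2_eq_square)
  have lin: "det2 (a *\<^sub>R T) (b *\<^sub>R N - c *\<^sub>R T) = a * b * det2 T N" for a b c T N
    by (simp add: det2_eq algebra_simps)
  have "S_deriv \<gamma> \<theta> \<gamma> u = inverse (\<theta> u) *\<^sub>R tangent \<gamma> u"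
    by (simp add: S_deriv_def tangent_def)
  moreover have "det2 (tangent \<gamma> u) (unit_normal \<gamma> u) = 1"
    using n by (simp add: unit_normal_eq norm_tangent det2_eq power2_eq_square)
  ultimately show ?thesis
    by (simp add: S_curvature_def S_deriv_twice[OF assms] lin divide_inverse
        power2_eq_square power3_eq_cube)
qed

lemma affine_density_eq:
  assumes "affine_arc_length p \<gamma> S \<theta>" "curvature \<gamma> u > 0"
  shows "\<theta> u > 0" "(\<theta> u)^3 = curvature \<gamma> u" "\<theta> u = curvature \<gamma> u powr (1/3)"
proof -
  have a: "\<theta> u \<ge> 0" "\<theta> differentiable (at u)" "\<bar>S_curvature \<gamma> \<theta> u\<bar> = 1"
    using assms(1) by (auto simp: affine_arc_length_def)
  \<comment> \<open>Since \<open>inverse 0 = 0\<close>, a zero of \<theta> would give K = 0.\<close>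
  have "\<theta> u \<noteq> 0"
    using a(3) by (auto simp: S_curvature_def S_deriv_def det2_eq)
  then show pos: "\<theta> u > 0"
    using a(1) by simp
  \<comment> \<open>Both k and \<theta> are positive, so K = k / \<theta>^3 is positive and the
    absolute value disappears.\<close>
  then show cube: "(\<theta> u)^3 = curvature \<gamma> u"
    using a S_curvature_eq[of \<theta> u] assms(2) by (simp add: abs_divide)
  have "((\<theta> u)^3) powr (1/3) = \<theta> u"
    using pos powr_powr[of "\<theta> u" 3 "1/3"] by simp
  then show "\<theta> u = curvature \<gamma> u powr (1/3)"
    using pos cube by simp
qed

end

theorem proposition1:
  fixes X :: "real \<Rightarrow> real \<Rightarrow> real^2"
    and S \<theta> :: "real \<Rightarrow> real \<Rightarrow> real"
    and I :: "real set" and p :: real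
  assumes "is_interval I" and "interior I \<noteq> {}"
    and smooth: "smooth_on (\<lambda>(t, u). X t u) (I \<times> UNIV)"
    and convex: "\<And>t. t \<in> I \<Longrightarrow> closed_convex_curve p (X t)"
    and affine: "\<And>t. t \<in> I \<Longrightarrow> affine_arc_length p (X t) (S t) (\<theta> t)"
    and heat: "\<And>t u. t \<in> I \<Longrightarrow>
      vector_derivative (\<lambda>\<tau>. X \<tau> u) (at t within I) =
        S_deriv (X t) (\<theta> t) (S_deriv (X t) (\<theta> t) (X t)) u"
  shows "\<forall>t\<in>I. \<forall>u.
    (let k = curvature (X t);
         \<beta> = (\<lambda>v. k v powr (1/3));
         \<alpha> = (\<lambda>v. - arc_deriv (X t) \<beta> v / k v)
     in vector_derivative (\<lambda>\<tau>. X \<tau> u) (at t within I) =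
          \<beta> u *\<^sub>R unit_normal (X t) u + \<alpha> u *\<^sub>R tangent (X t) u)"

proof (intro ballI allI)
  fix t u assume t: "t \<in> I"
  let ?k = "curvature (X t)" and ?\<beta> = "\<lambda>v. curvature (X t) v powr (1/3)"
  have reg: "regular_closed_curve p (X t)" and k: "?k v > 0" for v
    using convex[OF t] by (auto simp: closed_convex_curve_def)
  note density = affine_density_eq[OF reg affine[OF t] k]
  \<comment> \<open>An equality of functions is needed, not just of values at \<open>u\<close>,
    because \<alpha> differentiates \<beta> along the curve.\<close>
  have \<beta>: "\<theta> t = ?\<beta>"
    using density(3) by blast
  have "\<theta> t differentiable (at u)"
    using affine[OF t] by (simp add: affine_arc_length_def)
  \<comment> \<open>With \<theta>^3 = k the normal coefficient becomes \<theta> = \<beta>, and the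
    denominator \<theta>^3 of the tangential one becomes k.\<close>
  moreover have "?k u / (\<theta> t u)\<^sup>2 = \<theta> t u"
    using density(1,2)[of u] by (simp add: field_simps power2_eq_square power3_eq_cube)
  ultimately have "vector_derivative (\<lambda>\<tau>. X \<tau> u) (at t within I) =
      \<theta> t u *\<^sub>R unit_normal (X t) u - (arc_deriv (X t) (\<theta> t) u / ?k u) *\<^sub>R tangent (X t) u"
    using heat[OF t, of u] S_deriv_twice[OF reg, of "\<theta> t" u] density(1,2)[of u] by simp
  then show "let k = ?k;
         \<beta> = (\<lambda>v. k v powr (1/3));
         \<alpha> = (\<lambda>v. - arc_deriv (X t) \<beta> v / k v)
     in vector_derivative (\<lambda>\<tau>. X \<tau> u) (at t within I) =
          \<beta> u *\<^sub>R unit_normal (X t) u + \<alpha> u *\<^sub>R tangent (X t) u"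
    unfolding Let_def \<beta> by simp
qed

end
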